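(* Let $i\in\{1,2\}$, $\varepsilon=(-1)^i$, and let $\mathcal{S}_i$ be the timelike general rotational surface of first type ($i=1$) or second type ($i=2$) determined by $f,g,\alpha,\beta$. Let $\lambda_1,\lambda_2,\lambda_3,\lambda_4\in\mathbb{R}$ be not all zero and equip $\mathbb{E}_1^4$ with the density $e^{\phi}$, $\phi=\lambda_1x^2+\lambda_2y^2+\lambda_3z^2+\lambda_4t^2$. Then the weighted mean curvature of $\mathcal{S}_i$ at $(u,v)$ is $$H_\phi^{\mathcal{S}_i}=\sqrt{\frac{P^2+f^2g^2\left(\varepsilon(\alpha f)^2+(\beta g)^2\right)\left(\varepsilon\beta(\lambda_1-\lambda_2)\sin(2\alpha v)+\alpha(\lambda_3+\lambda_4)\sinh(2\beta v)\right)^2\left(-\varepsilon f'^2+g'^2\right)^3}{4\left((\alpha f)^2+\varepsilon(\beta g)^2\right)^2\left(-\varepsilon f'^2+g'^2\right)^3}},$$ where $$\begin{aligned}P={}&\left((\alpha f)^2+\varepsilon(\beta g)^2\right)\left(\varepsilon\left(\lambda_1+\lambda_2+(\lambda_1-\lambda_2)\cos(2\alpha v)\right)fg'\left(f'^2-\varepsilon g'^2\right)-g'f''+f'g''\right)\\&+\left(\left(\varepsilon(\lambda_4-\lambda_3)+(\lambda_3+\lambda_4)\cosh(2\beta v)\right)\left((\alpha f)^2+\varepsilon(\beta g)^2\right)f'g+\alpha^2fg'+\beta^2gf'\right)\left(f'^2-\varepsilon g'^2\right).\end{aligned}$$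
   Context: $\mathbb{E}_1^4$ is $\mathbb{R}^4$ with coordinates $(x,y,z,t)$ and the metric $\langle\,,\rangle=dx^2+dy^2+dz^2-dt^2$. Let $\alpha,\beta>0$ be constants, $J\subset\mathbb{R}$ an open interval, $f,g:J\to\mathbb{R}$ smooth functions of $u$ (primes denote $d/du$), and $v\in[0,2\pi)$. First type: $\mathcal{S}_1: X_1(u,v)=(f\cos(\alpha v),f\sin(\alpha v),g\cosh(\beta v),g\sinh(\beta v))$ with $\alpha^2f^2-\beta^2g^2<0$ and $f'^2+g'^2>0$ on $J$. Second type: $\mathcal{S}_2: X_2(u,v)=(f\cos(\alpha v),f\sin(\alpha v),g\sinh(\beta v),g\cosh(\beta v))$ with $f'^2-g'^2<0$ and $\alpha^2f^2+\beta^2g^2>0$ on $J$. Both surfaces are timelike. Normal frame of $\mathcal{S}_1$: $n_1^{\mathcal{S}_1}=\frac{1}{\sqrt{f'^2+g'^2}}(g'\cos(\alpha v),g'\sin(\alpha v),-f'\cosh(\beta v),-f'\sinh(\beta v))$, $n_2^{\mathcal{S}_1}=\frac{1}{\sqrt{(\beta g)^2-(\alpha f)^2}}(-\beta g\sin(\alpha v),\beta g\cos(\alpha v),\alpha f\sinh(\beta v),\alpha f\cosh(\beta v))$. Normal frame of $\mathcal{S}_2$: $n_1^{\mathcal{S}_2}=\frac{1}{\sqrt{(\alpha f)^2+(\beta g)^2}}(\beta g\sin(\alpha v),-\beta g\cos(\alpha v),\alpha f\cosh(\beta v),\alpha f\sinh(\beta v))$, $n_2^{\mathcal{S}_2}=\frac{1}{\sqrt{g'^2-f'^2}}(g'\cos(\alpha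 v),g'\sin(\alpha v),f'\sinh(\beta v),f'\cosh(\beta v))$. With $\varepsilon=(-1)^i$, the $j$-th mean curvatures of $\mathcal{S}_i$ ($j\in\{1,2\}$) are the functions $H_j^{\mathcal{S}_i}=0$ if $j\neq i$, and $$H_i^{\mathcal{S}_i}=\frac{(f'g''-f''g')\left((\alpha f)^2+\varepsilon(\beta g)^2\right)-\varepsilon(\alpha^2fg'+\beta^2gf')(-\varepsilon f'^2+g'^2)}{2(-\varepsilon f'^2+g'^2)^{3/2}\left((\alpha f)^2+\varepsilon(\beta g)^2\right)}.$$ For a density $e^\phi$, the $j$-th weighted mean curvature function is $(H_j^{\mathcal{S}_i})_\phi=H_j^{\mathcal{S}_i}-\frac12\frac{d\phi}{dn_j^{\mathcal{S}_i}}$, where $\frac{d\phi}{dn}=d\phi(n)$ is the directional derivative of $\phi$ along $n$ at the point of the surface. The weighted mean curvature vector field is $\overrightarrow{H_\phi^{\mathcal{S}_i}}=(H_1^{\mathcal{S}_i})_\phi n_1^{\mathcal{S}_i}+(H_2^{\mathcal{S}_i})_\phi n_2^{\mathcal{S}_i}$ and the weighted mean curvature is $H_\phi^{\mathcal{S}_i}=\|\overrightarrow{H_\phi^{\mathcal{S}_i}}\|$, with $\|V\|=\sqrt{|\langle V,V\rangle|}$. *)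

theory Defs
  imports "HOL-Analysis.Analysis"
begin

text \<open>
  Minkowski space-time is the type \<^typ>\<open>real^4\<close>; the coordinates \<open>x, y, z, t\<close> are the
  components \<open>1, 2, 3, 4\<close>, the last one being the time coordinate.
\<close>

definition minkowski :: "real^4 \<Rightarrow> real^4 \<Rightarrow> real" where
  "minkowski V W = V$1 * W$1 + V$2 * W$2 + V$3 * W$3 - V$4 * W$4"

definition minkowski_norm :: "real^4 \<Rightarrow> real" where
  "minkowski_norm V = sqrt \<bar>minkowski V V\<bar>"

text \<open>
  Used for open \<open>J\<close> only, where it says that all iterated derivatives exist on \<open>J\<close>. The profile
  functions are total, but only their values on \<open>J\<close> matter.
\<close>

definition smooth_on :: "real set \<Rightarrow> (real \<Rightarrow> real) \<Rightarrow> bool" where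
  "smooth_on J f \<longleftrightarrow> (\<forall>k. ((deriv ^^ k) f) differentiable_on J)"

text \<open>
  In all definitions below the natural number \<open>i\<close> selects the type of the surface. Only
  \<open>i = 1\<close> and \<open>i = 2\<close> are meaningful; the \<open>else\<close> branches describe the second type.
\<close>

definition surface :: "nat \<Rightarrow> real \<Rightarrow> real \<Rightarrow> (real \<Rightarrow> real) \<Rightarrow> (real \<Rightarrow> real) \<Rightarrow> real \<Rightarrow> real \<Rightarrow> real^4" where
  "surface i \<alpha> \<beta> f g u v =
     (if i = 1
      then vector [f u * cos (\<alpha> * v), f u * sin (\<alpha> * v), g u * cosh (\<beta> * v), g u * sinh (\<beta> * v)]
      else vector [f u * cos (\<alpha> * v), f u * sin (\<alpha> * v), g u * sinh (\<beta> * v), g u * cosh (\<beta> * v)])"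

text \<open>
  The inequalities make the induced metric of the surface Lorentzian, i.e. the surface timelike.
\<close>

definition timelike_general_rotational_surface ::
    "nat \<Rightarrow> real \<Rightarrow> real \<Rightarrow> real set \<Rightarrow> (real \<Rightarrow> real) \<Rightarrow> (real \<Rightarrow> real) \<Rightarrow> bool" where
  "timelike_general_rotational_surface i \<alpha> \<beta> J f g \<longleftrightarrow>
     0 < \<alpha> \<and> 0 < \<beta> \<and> open J \<and> is_interval J \<and> smooth_on J f \<and> smooth_on J g \<and>
     (\<forall>u\<in>J.
        if i = 1
        then \<alpha>^2 * (f u)^2 - \<beta>^2 * (g u)^2 < 0 \<and> 0 < (deriv f u)^2 + (deriv g u)^2
        else (deriv f u)^2 - (deriv g u)^2 < 0 \<and> 0 < \<alpha>^2 * (f u)^2 + \<beta>^2 * (g u)^2)"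

text \<open>\<open>normal i j\<close> is the \<open>j\<close>-th vector of the normal frame, for \<open>j = 1\<close> and \<open>j = 2\<close>.\<close>

definition normal ::
    "nat \<Rightarrow> nat \<Rightarrow> real \<Rightarrow> real \<Rightarrow> (real \<Rightarrow> real) \<Rightarrow> (real \<Rightarrow> real) \<Rightarrow> real \<Rightarrow> real \<Rightarrow> real^4" where
  "normal i j \<alpha> \<beta> f g u v =
     (let f' = deriv f u; g' = deriv g u in
      if i = 1 then
        (if j = 1
         then (1 / sqrt (f'^2 + g'^2)) *\<^sub>R
           vector [g' * cos (\<alpha> * v), g' * sin (\<alpha> * v), - f' * cosh (\<beta> * v), - f' * sinh (\<beta> * v)]
         else (1 / sqrt ((\<beta> * g u)^2 - (\<alpha> * f u)^2)) *\<^sub>R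
           vector [- \<beta> * g u * sin (\<alpha> * v), \<beta> * g u * cos (\<alpha> * v),
                   \<alpha> * f u * sinh (\<beta> * v), \<alpha> * f u * cosh (\<beta> * v)])
      else
        (if j = 1
         then (1 / sqrt ((\<alpha> * f u)^2 + (\<beta> * g u)^2)) *\<^sub>R
           vector [\<beta> * g u * sin (\<alpha> * v), - \<beta> * g u * cos (\<alpha> * v),
                   \<alpha> * f u * cosh (\<beta> * v), \<alpha> * f u * sinh (\<beta> * v)]
         else (1 / sqrt (g'^2 - f'^2)) *\<^sub>R
           vector [g' * cos (\<alpha> * v), g' * sin (\<alpha> * v), f' * sinh (\<beta> * v), f' * cosh (\<beta> * v)]))"

text \<open>
  The \<open>j\<close>-th mean curvature, in the closed form for these surfaces; the power \<open>3/2\<close> is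
  only ever taken of a positive number.
\<close>

definition mean_curvature ::
    "nat \<Rightarrow> nat \<Rightarrow> real \<Rightarrow> real \<Rightarrow> (real \<Rightarrow> real) \<Rightarrow> (real \<Rightarrow> real) \<Rightarrow> real \<Rightarrow> real" where
  "mean_curvature i j \<alpha> \<beta> f g u =
     (if j \<noteq> i then 0
      else
        let \<epsilon> = (- 1) ^ i;
            f' = deriv f u; f'' = deriv (deriv f) u;
            g' = deriv g u; g'' = deriv (deriv g) u
        in ((f' * g'' - f'' * g') * ((\<alpha> * f u)^2 + \<epsilon> * (\<beta> * g u)^2)
              - \<epsilon> * (\<alpha>^2 * f u * g' + \<beta>^2 * g u * f') * (- \<epsilon> * f'^2 + g'^2))
           / (2 * (- \<epsilon> * f'^2 + g'^2) powr (3/2) * ((\<alpha> * f u)^2 + \<epsilon> * (\<beta> * g u)^2)))"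

text \<open>
  In the weighted notions below the argument \<open>\<phi>\<close> is the logarithm of the density \<open>e\<^sup>\<phi>\<close>.
\<close>

definition weighted_mean_curvature_function ::
    "(real^4 \<Rightarrow> real) \<Rightarrow> nat \<Rightarrow> nat \<Rightarrow> real \<Rightarrow> real \<Rightarrow> (real \<Rightarrow> real) \<Rightarrow> (real \<Rightarrow> real) \<Rightarrow> real \<Rightarrow> real \<Rightarrow> real" where
  "weighted_mean_curvature_function \<phi> i j \<alpha> \<beta> f g u v =
     mean_curvature i j \<alpha> \<beta> f g u
     - 1/2 * frechet_derivative \<phi> (at (surface i \<alpha> \<beta> f g u v)) (normal i j \<alpha> \<beta> f g u v)"

definition weighted_mean_curvature_vector ::
    "(real^4 \<Rightarrow> real) \<Rightarrow> nat \<Rightarrow> real \<Rightarrow> real \<Rightarrow> (real \<Rightarrow> real) \<Rightarrow> (real \<Rightarrow> real) \<Rightarrow> real \<Rightarrow> real \<Rightarrow> real^4" where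
  "weighted_mean_curvature_vector \<phi> i \<alpha> \<beta> f g u v =
     weighted_mean_curvature_function \<phi> i 1 \<alpha> \<beta> f g u v *\<^sub>R normal i 1 \<alpha> \<beta> f g u v
     + weighted_mean_curvature_function \<phi> i 2 \<alpha> \<beta> f g u v *\<^sub>R normal i 2 \<alpha> \<beta> f g u v"

definition weighted_mean_curvature ::
    "(real^4 \<Rightarrow> real) \<Rightarrow> nat \<Rightarrow> real \<Rightarrow> real \<Rightarrow> (real \<Rightarrow> real) \<Rightarrow> (real \<Rightarrow> real) \<Rightarrow> real \<Rightarrow> real \<Rightarrow> real" where
  "weighted_mean_curvature \<phi> i \<alpha> \<beta> f g u v =
     minkowski_norm (weighted_mean_curvature_vector \<phi> i \<alpha> \<beta> f g u v)"

end

theory Submission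
  imports Defs
begin

text \<open>
  The two normal vectors are spacelike, of length one and mutually orthogonal, so the square of
  the weighted mean curvature is the sum of the squares of the two weighted mean curvature
  functions (\<open>minkowski_norm_orthonormal_combination\<close>). It remains to compute these. Write
  \<open>W = - \<epsilon> f'\<^sup>2 + g'\<^sup>2\<close> and \<open>D = (\<alpha> f)\<^sup>2 + \<epsilon> (\<beta> g)\<^sup>2\<close>; the surface being timelike means
  \<open>W > 0\<close> and \<open>\<epsilon> D > 0\<close>.

  The differential of \<open>\<phi>\<close> is a diagonal bilinear form in the point and the direction. The normal
  with index \<open>i\<close> has the same trigonometric and hyperbolic factors as the position vector, so
  squares of \<open>cos\<close>, \<open>sin\<close>, \<open>cosh\<close>, \<open>sinh\<close> arise, and these become the terms in
  \<open>cos (2 \<alpha> v)\<close> and \<open>cosh (2 \<beta> v)\<close>. Together with the unweighted mean curvature, which only this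
  normal carries, they form \<open>P / (2 W\<^bsup>3/2\<^esup> D)\<close>. In the other normal the factors are interchanged,
  so mixed products arise, and these become the terms in \<open>sin (2 \<alpha> v)\<close> and \<open>sinh (2 \<beta> v)\<close>,
  divided by \<open>\<surd>(\<epsilon> D)\<close>. Since \<open>\<epsilon>\<^sup>2 = 1\<close>, squaring, adding and passing to the common denominator
  \<open>4 D\<^sup>2 W\<^sup>3\<close> gives the formula (\<open>sum_of_squares_common_denominator\<close>).
\<close>

section \<open>Minkowski geometry of the normal frame\<close>

lemma vector_4 [simp]:
  fixes a b c d :: "'a::zero"
  shows "(vector [a, b, c, d] :: 'a^4) $ 1 = a" "(vector [a, b, c, d] :: 'a^4) $ 2 = b"
    "(vector [a, b, c, d] :: 'a^4) $ 3 = c" "(vector [a, b, c, d] :: 'a^4) $ 4 = d"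
  unfolding vector_def by simp_all

lemma minkowski_norm_orthonormal_combination:
  assumes "minkowski m m = 1" "minkowski n n = 1" "minkowski m n = 0"
  shows "minkowski_norm (a *\<^sub>R m + b *\<^sub>R n) = sqrt (a\<^sup>2 + b\<^sup>2)"
proof -
  have "minkowski (a *\<^sub>R m + b *\<^sub>R n) (a *\<^sub>R m + b *\<^sub>R n)
      = a\<^sup>2 * minkowski m m + b\<^sup>2 * minkowski n n + 2 * a * b * minkowski m n"
    by (simp add: minkowski_def algebra_simps power2_eq_square)
  then have "minkowski (a *\<^sub>R m + b *\<^sub>R n) (a *\<^sub>R m + b *\<^sub>R n) = a\<^sup>2 + b\<^sup>2"
    using assms by simp
  then show ?thesis
    by (simp add: minkowski_norm_def)
qed

lemma minkowski_scaleR: "minkowski (a *\<^sub>R m) (b *\<^sub>R n) = a * b * minkowski m n"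
  by (simp add: minkowski_def algebra_simps)

text \<open>
  The rotation by \<open>a\<close> of the \<open>xy\<close>-plane and the boost by \<open>b\<close> of the \<open>zt\<close>-plane are isometries, so
  the form of two vectors is found from their coordinates \<open>p, q, r, s\<close> in the moved standard
  basis. In such a basis, with \<open>a = \<alpha> v\<close> and \<open>b = \<beta> v\<close>, the coordinates of all four normals
  are free of \<open>v\<close>.
\<close>

lemma minkowski_rotated:
  "minkowski
     (vector [p * cos a - q * sin a, p * sin a + q * cos a,
              r * cosh b + s * sinh b, r * sinh b + s * cosh b])
     (vector [p' * cos a - q' * sin a, p' * sin a + q' * cos a,
              r' * cosh b + s' * sinh b, r' * sinh b + s' * cosh b])
   = p * p' + q * q' + r * r' - s * s'"
proof -
  have "minkowski
     (vector [p * cos a - q * sin a, p * sin a + q * cos a,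
              r * cosh b + s * sinh b, r * sinh b + s * cosh b])
     (vector [p' * cos a - q' * sin a, p' * sin a + q' * cos a,
              r' * cosh b + s' * sinh b, r' * sinh b + s' * cosh b])
   = (p * p' + q * q') * ((cos a)\<^sup>2 + (sin a)\<^sup>2) + (r * r' - s * s') * ((cosh b)\<^sup>2 - (sinh b)\<^sup>2)"
    unfolding minkowski_def vector_4 by algebra
  then show ?thesis
    by (simp add: hyperbolic_pythagoras)
qed

lemma normal_frame_first_type:
  assumes "0 < (deriv f u)\<^sup>2 + (deriv g u)\<^sup>2" "(\<alpha> * f u)\<^sup>2 < (\<beta> * g u)\<^sup>2"
  shows "minkowski (normal 1 1 \<alpha> \<beta> f g u v) (normal 1 1 \<alpha> \<beta> f g u v) = 1"
    and "minkowski (normal 1 2 \<alpha> \<beta> f g u v) (normal 1 2 \<alpha> \<beta> f g u v) = 1"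
    and "minkowski (normal 1 1 \<alpha> \<beta> f g u v) (normal 1 2 \<alpha> \<beta> f g u v) = 0"
  using assms
    minkowski_rotated [of "deriv g u" "\<alpha> * v" 0 "- deriv f u" "\<beta> * v" 0
      "deriv g u" 0 "- deriv f u" 0]
    minkowski_rotated [of 0 "\<alpha> * v" "\<beta> * g u" 0 "\<beta> * v" "\<alpha> * f u" 0 "\<beta> * g u" 0 "\<alpha> * f u"]
    minkowski_rotated [of "deriv g u" "\<alpha> * v" 0 "- deriv f u" "\<beta> * v" 0
      0 "\<beta> * g u" 0 "\<alpha> * f u"]
  by (auto simp: normal_def Let_def minkowski_scaleR power2_eq_square)

lemma normal_frame_second_type:
  assumes "(deriv f u)\<^sup>2 < (deriv g u)\<^sup>2" "0 < (\<alpha> * f u)\<^sup>2 + (\<beta> * g u)\<^sup>2"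
  shows "minkowski (normal 2 1 \<alpha> \<beta> f g u v) (normal 2 1 \<alpha> \<beta> f g u v) = 1"
    and "minkowski (normal 2 2 \<alpha> \<beta> f g u v) (normal 2 2 \<alpha> \<beta> f g u v) = 1"
    and "minkowski (normal 2 1 \<alpha> \<beta> f g u v) (normal 2 2 \<alpha> \<beta> f g u v) = 0"
  using assms
    minkowski_rotated [of 0 "\<alpha> * v" "- (\<beta> * g u)" "\<alpha> * f u" "\<beta> * v" 0
      0 "- (\<beta> * g u)" "\<alpha> * f u" 0]
    minkowski_rotated [of "deriv g u" "\<alpha> * v" 0 0 "\<beta> * v" "deriv f u"
      "deriv g u" 0 0 "deriv f u"]
    minkowski_rotated [of 0 "\<alpha> * v" "- (\<beta> * g u)" "\<alpha> * f u" "\<beta> * v" 0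
      "deriv g u" 0 0 "deriv f u"]
  by (auto simp: normal_def Let_def minkowski_scaleR power2_eq_square)

section \<open>The density along the normal directions\<close>

definition diagonal_quadratic :: "real \<Rightarrow> real \<Rightarrow> real \<Rightarrow> real \<Rightarrow> real^4 \<Rightarrow> real" where
  "diagonal_quadratic l1 l2 l3 l4 = (\<lambda>p. l1 * (p$1)^2 + l2 * (p$2)^2 + l3 * (p$3)^2 + l4 * (p$4)^2)"

lemma frechet_derivative_diagonal_quadratic:
  "frechet_derivative (diagonal_quadratic l1 l2 l3 l4) (at p) n
    = 2 * (l1 * p$1 * n$1 + l2 * p$2 * n$2 + l3 * p$3 * n$3 + l4 * p$4 * n$4)"
proof -
  have "(diagonal_quadratic l1 l2 l3 l4 has_derivative
      (\<lambda>n. 2 * (l1 * p$1 * n$1 + l2 * p$2 * n$2 + l3 * p$3 * n$3 + l4 * p$4 * n$4))) (at p)"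
    unfolding diagonal_quadratic_def
    by (auto intro!: derivative_eq_intros bounded_linear_imp_has_derivative
        simp: algebra_simps)
  then show ?thesis
    by (simp add: frechet_derivative_at [symmetric])
qed

text \<open>
  A diagonal form evaluated on parallel polar vectors, in the \<open>xy\<close>- and in the \<open>zt\<close>-plane. For
  equal weights the Euclidean form is constant, whereas the sum of the hyperbolic squares is
  constant for opposite weights; hence \<open>k + l\<close> and \<open>k - l\<close> exchange their places.
\<close>

lemma weighted_squares_double_angle:
  fixes x :: real
  shows "2 * (k * (cos x)\<^sup>2 + l * (sin x)\<^sup>2) = k + l + (k - l) * cos (2 * x)"
    and "2 * (k * (cosh x)\<^sup>2 + l * (sinh x)\<^sup>2) = k - l + (k + l) * cosh (2 * x)"
  unfolding cos_double cosh_double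
  using sin_cos_squared_add [of x] hyperbolic_pythagoras [of x] by algebra+

lemma density_along_normals_first_type:
  fixes \<alpha> \<beta> v :: real
  shows "frechet_derivative (diagonal_quadratic l1 l2 l3 l4) (at (surface 1 \<alpha> \<beta> f g u v))
      (normal 1 1 \<alpha> \<beta> f g u v)
    = ((l1 + l2 + (l1 - l2) * cos (2 * \<alpha> * v)) * f u * deriv g u
       - (l3 - l4 + (l3 + l4) * cosh (2 * \<beta> * v)) * g u * deriv f u)
      / sqrt ((deriv f u)\<^sup>2 + (deriv g u)\<^sup>2)" (is "?lhsA = ?rhsA")
    and "frechet_derivative (diagonal_quadratic l1 l2 l3 l4) (at (surface 1 \<alpha> \<beta> f g u v))
      (normal 1 2 \<alpha> \<beta> f g u v)
    = f u * g u * (- \<beta> * (l1 - l2) * sin (2 * \<alpha> * v) + \<alpha> * (l3 + l4) * sinh (2 * \<beta> * v))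
      / sqrt ((\<beta> * g u)\<^sup>2 - (\<alpha> * f u)\<^sup>2)" (is "?lhsB = ?rhsB")
proof -
  have "?lhsA = (2 * (l1 * (cos (\<alpha> * v))\<^sup>2 + l2 * (sin (\<alpha> * v))\<^sup>2) * f u * deriv g u
      - 2 * (l3 * (cosh (\<beta> * v))\<^sup>2 + l4 * (sinh (\<beta> * v))\<^sup>2) * g u * deriv f u)
      / sqrt ((deriv f u)\<^sup>2 + (deriv g u)\<^sup>2)"
    by (simp add: frechet_derivative_diagonal_quadratic surface_def normal_def
        Let_def add_divide_distrib diff_divide_distrib power2_eq_square algebra_simps)
  then show "?lhsA = ?rhsA"
    by (simp only: weighted_squares_double_angle mult.assoc)
  have "?lhsB = f u * g u * (- \<beta> * (l1 - l2) * (2 * sin (\<alpha> * v) * cos (\<alpha> * v))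
      + \<alpha> * (l3 + l4) * (2 * sinh (\<beta> * v) * cosh (\<beta> * v)))
      / sqrt ((\<beta> * g u)\<^sup>2 - (\<alpha> * f u)\<^sup>2)"
    by (simp add: frechet_derivative_diagonal_quadratic surface_def normal_def
        Let_def add_divide_distrib diff_divide_distrib algebra_simps)
  then show "?lhsB = ?rhsB"
    by (simp only: sin_double sinh_double mult.assoc)
qed

text \<open>
  In contrast to the first type, the \<open>t\<close>-component of the surface carries \<open>cosh\<close> and the
  \<open>z\<close>-component \<open>sinh\<close>, so \<open>l3\<close> and \<open>l4\<close> exchange their places in the squared terms, while the
  mixed products do not notice the change.
\<close>

lemma density_along_normals_second_type:
  fixes \<alpha> \<beta> v :: real
  shows "frechet_derivative (diagonal_quadratic l1 l2 l3 l4) (at (surface 2 \<alpha> \<beta> f g u v))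
      (normal 2 2 \<alpha> \<beta> f g u v)
    = ((l1 + l2 + (l1 - l2) * cos (2 * \<alpha> * v)) * f u * deriv g u
       + (l4 - l3 + (l3 + l4) * cosh (2 * \<beta> * v)) * g u * deriv f u)
      / sqrt ((deriv g u)\<^sup>2 - (deriv f u)\<^sup>2)" (is "?lhsA = ?rhsA")
    and "frechet_derivative (diagonal_quadratic l1 l2 l3 l4) (at (surface 2 \<alpha> \<beta> f g u v))
      (normal 2 1 \<alpha> \<beta> f g u v)
    = f u * g u * (\<beta> * (l1 - l2) * sin (2 * \<alpha> * v) + \<alpha> * (l3 + l4) * sinh (2 * \<beta> * v))
      / sqrt ((\<alpha> * f u)\<^sup>2 + (\<beta> * g u)\<^sup>2)" (is "?lhsB = ?rhsB")
proof -
  have "?lhsA = (2 * (l1 * (cos (\<alpha> * v))\<^sup>2 + l2 * (sin (\<alpha> * v))\<^sup>2) * f u * deriv g u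
      + 2 * (l4 * (cosh (\<beta> * v))\<^sup>2 + l3 * (sinh (\<beta> * v))\<^sup>2) * g u * deriv f u)
      / sqrt ((deriv g u)\<^sup>2 - (deriv f u)\<^sup>2)"
    by (simp add: frechet_derivative_diagonal_quadratic surface_def normal_def
        Let_def add_divide_distrib diff_divide_distrib power2_eq_square algebra_simps)
  then show "?lhsA = ?rhsA"
    by (simp only: weighted_squares_double_angle mult.assoc add.commute [of l3 l4])
  have "?lhsB = f u * g u * (\<beta> * (l1 - l2) * (2 * sin (\<alpha> * v) * cos (\<alpha> * v))
      + \<alpha> * (l3 + l4) * (2 * sinh (\<beta> * v) * cosh (\<beta> * v)))
      / sqrt ((\<alpha> * f u)\<^sup>2 + (\<beta> * g u)\<^sup>2)"
    by (simp add: frechet_derivative_diagonal_quadratic surface_def normal_def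
        Let_def add_divide_distrib diff_divide_distrib algebra_simps)
  then show "?lhsB = ?rhsB"
    by (simp only: sin_double sinh_double mult.assoc)
qed

section \<open>The weighted mean curvature\<close>

lemma weighted_mean_curvature_orthonormal:
  assumes "minkowski (normal i 1 \<alpha> \<beta> f g u v) (normal i 1 \<alpha> \<beta> f g u v) = 1"
    and "minkowski (normal i 2 \<alpha> \<beta> f g u v) (normal i 2 \<alpha> \<beta> f g u v) = 1"
    and "minkowski (normal i 1 \<alpha> \<beta> f g u v) (normal i 2 \<alpha> \<beta> f g u v) = 0"
  shows "weighted_mean_curvature \<phi> i \<alpha> \<beta> f g u v
    = sqrt ((weighted_mean_curvature_function \<phi> i 1 \<alpha> \<beta> f g u v)\<^sup>2
      + (weighted_mean_curvature_function \<phi> i 2 \<alpha> \<beta> f g u v)\<^sup>2)"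
  unfolding weighted_mean_curvature_def weighted_mean_curvature_vector_def
  by (rule minkowski_norm_orthonormal_combination [OF assms])

lemma powr_three_halves:
  fixes x :: real
  assumes "0 < x"
  shows "x powr (3/2) = x * sqrt x"
proof -
  have "x powr (3/2) = x powr (1 + 1/2)"
    by simp
  also have "\<dots> = x * sqrt x"
    using assms by (simp only: powr_add powr_half_sqrt powr_one)
  finally show ?thesis .
qed

text \<open>
  Here \<open>N\<close> is the numerator of the unweighted mean curvature and \<open>K / \<surd>W\<close> the derivative of \<open>\<phi>\<close>
  along the normal that carries it; the numerator on the right will turn out to be \<open>P\<close>.
\<close>

lemma curvature_minus_density:
  fixes W D N K :: real
  assumes "0 < W" "D \<noteq> 0"
  shows "N / (2 * W powr (3/2) * D) - 1/2 * (K / sqrt W) = (N - W * D * K) / (2 * W powr (3/2) * D)"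
proof -
  have "sqrt W \<noteq> 0" "W \<noteq> 0"
    using assms by auto
  then show ?thesis
    using assms by (simp add: powr_three_halves field_simps)
qed

text \<open>
  The two summands are the squares of the weighted mean curvature functions of the two normals.
  The sign \<open>e\<close> makes \<open>e D\<close> positive under the root and disappears from the common denominator,
  since \<open>(e D)\<^sup>2 = D\<^sup>2\<close>.
\<close>

lemma sum_of_squares_common_denominator:
  fixes W D P Q e :: real
  assumes "0 < W" "0 < e * D" "e\<^sup>2 = 1"
  shows "(P / (2 * W powr (3/2) * D))\<^sup>2 + (- 1/2 * (Q / sqrt (e * D)))\<^sup>2
    = (P\<^sup>2 + Q\<^sup>2 * (e * D) * W^3) / (4 * D\<^sup>2 * W^3)"
proof -
  have D: "D \<noteq> 0" "(e * D)\<^sup>2 = D\<^sup>2"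
    using assms by (auto simp: power_mult_distrib)
  have "(P / (2 * W powr (3/2) * D))\<^sup>2 = P\<^sup>2 / (4 * D\<^sup>2 * W^3)"
    using assms(1)
    by (simp add: powr_three_halves power_mult_distrib power_divide power3_eq_cube
        power2_eq_square mult_ac)
  moreover have "(- 1/2 * (Q / sqrt (e * D)))\<^sup>2 = Q\<^sup>2 / (4 * (e * D))"
    using assms(2) by (simp add: power_mult_distrib power_divide)
  moreover have "\<dots> = Q\<^sup>2 * (e * D) * W^3 / (4 * (e * D)\<^sup>2 * W^3)"
    using assms(1,2) by (simp add: power2_eq_square)
  ultimately show ?thesis
    by (simp add: D(2) add_divide_distrib)
qed

theorem proposition1:
  fixes i :: nat and \<epsilon> \<alpha> \<beta> :: real and J :: "real set" and f g :: "real \<Rightarrow> real"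
    and l1 l2 l3 l4 :: real and \<phi> :: "real^4 \<Rightarrow> real"
    and u v f0 g0 f' g' f'' g'' P :: real
  assumes "i \<in> {1, 2}"
    and "\<epsilon> = (- 1) ^ i"
    and "timelike_general_rotational_surface i \<alpha> \<beta> J f g"
    and "\<not> (l1 = 0 \<and> l2 = 0 \<and> l3 = 0 \<and> l4 = 0)"
    and "\<phi> = (\<lambda>p. l1 * (p$1)^2 + l2 * (p$2)^2 + l3 * (p$3)^2 + l4 * (p$4)^2)"
    and "u \<in> J"
    and "v \<in> {0..<2 * pi}"
    and "f0 = f u" and "f' = deriv f u" and "f'' = deriv (deriv f) u"
    and "g0 = g u" and "g' = deriv g u" and "g'' = deriv (deriv g) u"
    and "P = ((\<alpha> * f0)^2 + \<epsilon> * (\<beta> * g0)^2)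
               * (\<epsilon> * (l1 + l2 + (l1 - l2) * cos (2 * \<alpha> * v)) * f0 * g' * (f'^2 - \<epsilon> * g'^2)
                  - g' * f'' + f' * g'')
             + ((\<epsilon> * (l4 - l3) + (l3 + l4) * cosh (2 * \<beta> * v))
                  * ((\<alpha> * f0)^2 + \<epsilon> * (\<beta> * g0)^2) * f' * g0
                + \<alpha>^2 * f0 * g' + \<beta>^2 * g0 * f')
               * (f'^2 - \<epsilon> * g'^2)"
  shows "weighted_mean_curvature \<phi> i \<alpha> \<beta> f g u v =
    sqrt ((P^2 + f0^2 * g0^2 * (\<epsilon> * (\<alpha> * f0)^2 + (\<beta> * g0)^2)
                 * (\<epsilon> * \<beta> * (l1 - l2) * sin (2 * \<alpha> * v) + \<alpha> * (l3 + l4) * sinh (2 * \<beta> * v))^2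
                 * (- \<epsilon> * f'^2 + g'^2)^3)
          / (4 * ((\<alpha> * f0)^2 + \<epsilon> * (\<beta> * g0)^2)^2 * (- \<epsilon> * f'^2 + g'^2)^3))"
proof -
  have \<phi>: "\<phi> = diagonal_quadratic l1 l2 l3 l4"
    using assms(5) by (simp add: diagonal_quadratic_def)
  define W where "W = - \<epsilon> * f'^2 + g'^2"
  define D where "D = (\<alpha> * f0)^2 + \<epsilon> * (\<beta> * g0)^2"
  define Q where "Q = f0 * g0 * (\<epsilon> * \<beta> * (l1 - l2) * sin (2 * \<alpha> * v) + \<alpha> * (l3 + l4) * sinh (2 * \<beta> * v))"
  have \<epsilon>2: "\<epsilon>\<^sup>2 = 1"
    using assms(1,2) by auto
  \<comment> \<open>\<open>K / \<surd>W\<close> is the derivative of \<open>\<phi>\<close> along the normal with index \<open>i\<close>, and \<open>N\<close> is the numerator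
     of the unweighted mean curvature. The factor \<open>\<epsilon>\<close> before the hyperbolic part of \<open>K\<close> is the
     sign of \<open>f'\<close> in that normal.\<close>
  define K where "K = (l1 + l2 + (l1 - l2) * cos (2 * \<alpha> * v)) * f0 * g'
    + \<epsilon> * (\<epsilon> * (l4 - l3) + (l3 + l4) * cosh (2 * \<beta> * v)) * g0 * f'"
  define N where "N = (f' * g'' - f'' * g') * D - \<epsilon> * (\<alpha>\<^sup>2 * f0 * g' + \<beta>\<^sup>2 * g0 * f') * W"
  have "N - W * D * K = P"
    using \<epsilon>2 unfolding N_def K_def W_def D_def assms(14) by algebra
  moreover have "mean_curvature i i \<alpha> \<beta> f g u = N / (2 * W powr (3/2) * D)"
    by (simp add: mean_curvature_def Let_def N_def W_def D_def assms(2,8-13))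
  ultimately have main_function:
    "weighted_mean_curvature_function \<phi> i i \<alpha> \<beta> f g u v = P / (2 * W powr (3/2) * D)"
    if "frechet_derivative \<phi> (at (surface i \<alpha> \<beta> f g u v)) (normal i i \<alpha> \<beta> f g u v) = K / sqrt W"
      "0 < W" "0 < \<epsilon> * D"
    unfolding weighted_mean_curvature_function_def that(1)
    using curvature_minus_density [of W D N K] that(2,3) by (cases "D = 0") auto
  \<comment> \<open>The fractional power and the square root in the next claim are meaningful by its first two
     parts, which are the conditions for a timelike surface.\<close>
  have main: "0 < W \<and> 0 < \<epsilon> * D \<and> weighted_mean_curvature \<phi> i \<alpha> \<beta> f g u v
      = sqrt ((P / (2 * W powr (3/2) * D))\<^sup>2 + (- 1/2 * (Q / sqrt (\<epsilon> * D)))\<^sup>2)"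
  proof (cases "i = 1")
    case True
    then have e: "\<epsilon> = - 1"
      using assms(2) by simp
    have pos: "0 < (deriv f u)\<^sup>2 + (deriv g u)\<^sup>2" "(\<alpha> * f u)\<^sup>2 < (\<beta> * g u)\<^sup>2"
      using assms(3,6) True
      by (auto simp: timelike_general_rotational_surface_def power_mult_distrib)
    have W: "W = (deriv f u)\<^sup>2 + (deriv g u)\<^sup>2" "0 < W"
      and D: "\<epsilon> * D = (\<beta> * g u)\<^sup>2 - (\<alpha> * f u)\<^sup>2" "0 < \<epsilon> * D"
      using pos by (auto simp: W_def D_def e assms(8-13))
    have "frechet_derivative \<phi> (at (surface i \<alpha> \<beta> f g u v)) (normal i i \<alpha> \<beta> f g u v) = K / sqrt W"
      unfolding \<phi> W(1) True density_along_normals_first_type(1)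
      by (simp add: K_def e assms(8-13) algebra_simps)
    then have "weighted_mean_curvature_function \<phi> i i \<alpha> \<beta> f g u v = P / (2 * W powr (3/2) * D)"
      using main_function W(2) D(2) by blast
    moreover have "weighted_mean_curvature_function \<phi> 1 2 \<alpha> \<beta> f g u v
        = - 1/2 * (Q / sqrt (\<epsilon> * D))"
      unfolding weighted_mean_curvature_function_def \<phi> density_along_normals_first_type(2) D(1) Q_def
      by (simp add: mean_curvature_def e assms(8,11))
    ultimately show ?thesis
      using W(2) D(2)
      by (simp only: True simp_thms
          weighted_mean_curvature_orthonormal [OF normal_frame_first_type [OF pos]])
  next
    case False
    then have i: "i = 2"
      using assms(1) by simp
    then have e: "\<epsilon> = 1"
      using assms(2) by simp
    have pos: "(deriv f u)\<^sup>2 < (deriv g u)\<^sup>2" "0 < (\<alpha> * f u)\<^sup>2 + (\<beta> * g u)\<^sup>2"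
      using assms(3,6) i
      by (auto simp: timelike_general_rotational_surface_def power_mult_distrib)
    have W: "W = (deriv g u)\<^sup>2 - (deriv f u)\<^sup>2" "0 < W"
      and D: "\<epsilon> * D = (\<alpha> * f u)\<^sup>2 + (\<beta> * g u)\<^sup>2" "0 < \<epsilon> * D"
      using pos by (auto simp: W_def D_def e assms(8-13))
    have "frechet_derivative \<phi> (at (surface i \<alpha> \<beta> f g u v)) (normal i i \<alpha> \<beta> f g u v) = K / sqrt W"
      unfolding \<phi> W(1) i density_along_normals_second_type(1)
      by (simp add: K_def e assms(8-13) algebra_simps)
    then have "weighted_mean_curvature_function \<phi> i i \<alpha> \<beta> f g u v = P / (2 * W powr (3/2) * D)"
      using main_function W(2) D(2) by blast
    moreover have "weighted_mean_curvature_function \<phi> 2 1 \<alpha> \<beta> f g u v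
        = - 1/2 * (Q / sqrt (\<epsilon> * D))"
      unfolding weighted_mean_curvature_function_def \<phi> density_along_normals_second_type(2) D(1) Q_def
      by (simp add: mean_curvature_def e assms(8,11))
    ultimately show ?thesis
      using W(2) D(2)
      by (simp only: i simp_thms add.commute
          weighted_mean_curvature_orthonormal [OF normal_frame_second_type [OF pos]])
  qed
  have "\<epsilon> * D = \<epsilon> * (\<alpha> * f0)^2 + (\<beta> * g0)^2"
    using \<epsilon>2 by (simp add: D_def distrib_left power2_eq_square mult.assoc [symmetric])
  then show ?thesis
    using main sum_of_squares_common_denominator [of W \<epsilon> D P Q] \<epsilon>2
    by (simp add: Q_def W_def D_def power_mult_distrib mult_ac)
qed

end
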